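(* For integers $\nu\ge1$ and $n>\nu(2\nu+3)$, \[ (-1)^\nu\left(\sum_{\tau=0}^{\nu}(-1)^\tau p_{2,4}\big(n-\tau(2\tau+1)\big)-\sum_{\tau=0}^{\nu-1}(-1)^\tau p_{2,4}\big(n-(\tau+1)(2\tau+1)\big)\right)=p_{2,4}(3,4,\nu;n)+p_{2,4}(1,4,\nu;n). \]
   Context: $p_{2,4}(n)$ is the number of partitions of $n$ with no part $\equiv 2\pmod 4$. Definition of $M(a,m,\nu;n)$ (integers $\nu\ge0$, $1\le a<m$, $n\ge0$): for a partition $\lambda_1\ge\dots\ge\lambda_k$ of $n$ into parts $\equiv a\pmod m$, put $\ell_i=(\lambda_i-a)/m+1$ (number of boxes of the row of $\lambda_i$ in the $m$-modular Young diagram), and let $t$ be the largest integer $0\le t\le k$ with $\ell_t\ge t+\nu+2$ (height of the $(\nu+2)$-Durfee rectangle, of width $t+\nu+2$). $M(a,m,\nu;n)$ counts partitions of $n$ into parts $\equiv a\pmod m$ in which each of $a,a+m,\dots,a+m\nu$ occurs at least once and $\ell_i<t+\nu+2$ for all $i>t$. Definition: for $a\in\{1,3\}$, $p_{2,4}(a,4,\nu;n)$ counts partitions of $n$ into parts $\not\equiv2\pmod4$ such that, if $\alpha$ is the sum of the parts $\not\equiv a\pmod 4$, the parts $\equiv a\pmod 4$ form a partition counted by $M(a,4,\nu;n-\alpha)$. *)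

theory Defs
  imports "HOL-Library.Multiset" "HOL-Number_Theory.Cong"
begin

text \<open>A partition of \<open>n\<close> is the multiset of its (positive) parts.\<close>

definition partitions_of :: "nat \<Rightarrow> nat multiset set" where
  "partitions_of n = {P. (\<forall>x \<in># P. 0 < x) \<and> sum_mset P = n}"

definition p24 :: "nat \<Rightarrow> nat" where
  "p24 n = card {P \<in> partitions_of n. \<forall>x \<in># P. \<not> [x = 2] (mod 4)}"

definition part :: "nat multiset \<Rightarrow> nat \<Rightarrow> nat" where
  "part P i = rev (sorted_list_of_multiset P) ! (i - 1)"
  \<comment> \<open>The parts in weakly decreasing order, indexed from 1 to the number of parts.\<close>

definition row_length :: "nat \<Rightarrow> nat \<Rightarrow> nat multiset \<Rightarrow> nat \<Rightarrow> nat" where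
  "row_length a m P i = (part P i - a) div m + 1"
  \<comment> \<open>Only used when \<open>1 \<le> a < m\<close> and all parts are congruent to \<open>a\<close> modulo \<open>m\<close>, so that the
      subtraction does not truncate and the division is exact.\<close>

definition durfee_height :: "nat \<Rightarrow> nat \<Rightarrow> nat \<Rightarrow> nat multiset \<Rightarrow> nat" where
  "durfee_height a m \<nu> P =
     Max {t. t \<le> size P \<and> (t = 0 \<or> t + \<nu> + 2 \<le> row_length a m P t)}"
  \<comment> \<open>Height of the Durfee rectangle whose width exceeds its height by \<open>\<nu> + 2\<close>; the condition
      is vacuous for \<open>t = 0\<close>.\<close>

definition M_partitions :: "nat \<Rightarrow> nat \<Rightarrow> nat \<Rightarrow> nat \<Rightarrow> nat multiset set" where
  "M_partitions a m \<nu> n =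
     {P \<in> partitions_of n.
        (\<forall>x \<in># P. [x = a] (mod m)) \<and>
        (\<forall>j \<le> \<nu>. a + m * j \<in># P) \<and>
        (\<forall>i. durfee_height a m \<nu> P < i \<and> i \<le> size P \<longrightarrow>
             row_length a m P i < durfee_height a m \<nu> P + \<nu> + 2)}"
  \<comment> \<open>The partitions counted by \<open>M(a, m, \<nu>; n)\<close>.\<close>

definition p24_M :: "nat \<Rightarrow> nat \<Rightarrow> nat \<Rightarrow> nat" where
  "p24_M a \<nu> n =
     card {P \<in> partitions_of n.
             (\<forall>x \<in># P. \<not> [x = 2] (mod 4)) \<and>
             (let \<alpha> = sum_mset {#x \<in># P. \<not> [x = a] (mod 4)#}
              in {#x \<in># P. [x = a] (mod 4)#} \<in> M_partitions a 4 \<nu> (n - \<alpha>))}"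
  \<comment> \<open>The count \<open>p\<^sub>2\<^sub>,\<^sub>4(a, 4, \<nu>; n)\<close>, for \<open>a\<close> equal to 1 or 3.\<close>

end

theory Submission
  imports Defs "HOL-Computational_Algebra.Formal_Power_Series"
begin

text \<open>
  Let \<open>R\<^sub>\<nu>\<close> be the right-hand side. For each residue \<open>a\<close>, the partitions containing
  \<open>a, a + 4, \<dots>, a + 4(\<nu> - 1)\<close> either are counted with parameter \<open>\<nu> - 1\<close> or have a row as long as
  the width of the Durfee rectangle just below it. Cutting up this row, one box for each row of the
  rectangle and the rest for a new row \<open>a + 4\<nu>\<close>, gives a bijection between the latter partitions and
  those counted with parameter \<open>\<nu>\<close>. Hence \<open>R\<^sub>\<nu> + R\<^bsub>\<nu>-1\<^esub> = p(n - \<nu>(2\<nu> - 1)) + p(n - \<nu>(2\<nu> + 1))\<close>.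
  As \<open>R\<^sub>\<nu> = 0\<close> for large \<open>\<nu>\<close>, this determines \<open>R\<^sub>0\<close> as an alternating sum, which is \<open>p(n)\<close> by the
  Jacobi triple product for \<open>(q, q\<^sup>3, q\<^sup>4; q\<^sup>4)\<^sub>\<infinity>\<close>; the theorem is the recurrence summed up to \<open>\<nu>\<close>.
\<close>

section \<open>Partitions with parts in a prescribed set\<close>

definition partitions_in :: "nat set \<Rightarrow> nat \<Rightarrow> nat multiset set" where
  "partitions_in S n = {P \<in> partitions_of n. set_mset P \<subseteq> S}"

lemma partitions_in_iff:
  "P \<in> partitions_in S n \<longleftrightarrow> (\<forall>x\<in>#P. 0 < x \<and> x \<in> S) \<and> sum_mset P = n"
  by (auto simp: partitions_in_def partitions_of_def)

lemma size_le_sum_mset: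
  fixes P :: "nat multiset"
  assumes "\<forall>x\<in>#P. 0 < x"
  shows "size P \<le> sum_mset P"
  using assms by (induction P) auto

lemma finite_partitions_in [simp]: "finite (partitions_in S n)"
proof -
  have "partitions_in S n \<subseteq> mset ` {xs. set xs \<subseteq> {..n} \<and> length xs \<le> n}"
  proof
    fix P assume P: "P \<in> partitions_in S n"
    obtain xs where xs: "P = mset xs" by (metis ex_mset)
    have "x \<le> n" if "x \<in># P" for x
      using P that by (auto simp: partitions_in_iff dest: multi_member_split)
    moreover have "size P \<le> n"
      using P size_le_sum_mset[of P] by (auto simp: partitions_in_iff)
    ultimately show "P \<in> mset ` {xs. set xs \<subseteq> {..n} \<and> length xs \<le> n}"
      using xs by (auto intro!: imageI)
  qed
  then show ?thesis
    by (rule finite_subset) (intro finite_imageI finite_lists_length_le finite_atMost)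
qed

text \<open>Adding and removing \<open>U\<close> are inverse bijections. Used with a single part for
  the generating function and with the required rows for the recurrence in \<nu>.\<close>

lemma card_partitions_in_containing:
  assumes U: "\<forall>x\<in>#U. 0 < x \<and> x \<in> S"
  shows "card {P \<in> partitions_in S n. U \<subseteq># P} =
    (if sum_mset U \<le> n then card (partitions_in S (n - sum_mset U)) else 0)"
proof (cases "sum_mset U \<le> n")
  case True
  have "bij_betw (\<lambda>P. P + U) (partitions_in S (n - sum_mset U)) {P \<in> partitions_in S n. U \<subseteq># P}"
  proof (rule bij_betw_byWitness[where f' = "\<lambda>P. P - U"])
    show "(\<lambda>P. P + U) ` partitions_in S (n - sum_mset U) \<subseteq> {P \<in> partitions_in S n. U \<subseteq># P}"
      using U True by (auto simp: partitions_in_iff)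
    show "(\<lambda>P. P - U) ` {P \<in> partitions_in S n. U \<subseteq># P} \<subseteq> partitions_in S (n - sum_mset U)"
    proof clarsimp
      fix P assume P: "P \<in> partitions_in S n" "U \<subseteq># P"
      then have "sum_mset (P - U) + sum_mset U = n"
        by (metis partitions_in_iff subset_mset.diff_add sum_mset.union)
      with P show "P - U \<in> partitions_in S (n - sum_mset U)"
        by (auto simp: partitions_in_iff dest: in_diffD)
    qed
  qed auto
  then show ?thesis using True by (simp add: bij_betw_same_card)
next
  case False
  have "{P \<in> partitions_in S n. U \<subseteq># P} = {}"
  proof (safe, goal_cases)
    case (1 P)
    then have "sum_mset (P - U) + sum_mset U = n"
      by (metis partitions_in_iff subset_mset.diff_add sum_mset.union)
    with False show ?case by simp
  qed
  then show ?thesis using False by (metis card.empty)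
qed

section \<open>The Durfee condition\<close>

text \<open>The congruence is built in so that a partition and its submultiset of parts in the class
  of \<open>a\<close> have the same count.\<close>

definition rows_from :: "nat \<Rightarrow> nat \<Rightarrow> nat multiset \<Rightarrow> nat \<Rightarrow> nat" where
  "rows_from a m P x = size {#y \<in># P. [y = a] (mod m) \<and> x \<le> y#}"

lemma rows_from_antimono: "x \<le> y \<Longrightarrow> rows_from a m P y \<le> rows_from a m P x"
  unfolding rows_from_def by (intro size_mset_mono filter_mset_mono_strong) auto

lemma le_nth_iff_length_filter:
  fixes xs :: "'a :: linorder list"
  assumes "sorted_wrt (\<ge>) xs" "i < length xs"
  shows "c \<le> xs ! i \<longleftrightarrow> i < length (filter (\<lambda>y. c \<le> y) xs)"
  using assms
proof (induction xs arbitrary: i)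
  case (Cons x xs)
  show ?case
  proof (cases "c \<le> x")
    case True
    with Cons show ?thesis by (cases i) auto
  next
    case False
    with Cons have "filter (\<lambda>y. c \<le> y) (x # xs) = []"
      by (auto simp: filter_empty_conv)
    moreover have "(x # xs) ! i \<le> x"
      using Cons by (cases i) auto
    ultimately show ?thesis using False by (auto simp del: filter.simps)
  qed
qed simp

lemma le_part_iff:
  assumes "0 < i" "i \<le> size P"
  shows "c \<le> part P i \<longleftrightarrow> i \<le> size {#y \<in># P. c \<le> y#}"
proof -
  let ?xs = "rev (sorted_list_of_multiset P)"
  have "mset ?xs = P" by simp
  then have len: "length ?xs = size P"
    and fil: "length (filter (\<lambda>y. c \<le> y) ?xs) = size {#y \<in># P. c \<le> y#}"
    by (metis size_mset, metis mset_filter size_mset)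
  have "sorted_wrt (\<ge>) ?xs" by (simp add: sorted_wrt_rev)
  from le_nth_iff_length_filter[OF this, of "i - 1" c] show ?thesis
    using assms len fil by (auto simp: part_def)
qed

text \<open>With \<open>0 < s\<close> the truncated subtraction in \<open>row_length\<close> is
  safe: the positive number \<open>m * s\<close> is only reached by parts larger than
  \<open>a\<close>.\<close>

lemma le_row_length_iff:
  assumes "0 < i" "i \<le> size P" "0 < m" "0 < s"
  shows "s + 1 \<le> row_length a m P i \<longleftrightarrow> i \<le> size {#y \<in># P. a + m * s \<le> y#}"
proof -
  have "s + 1 \<le> row_length a m P i \<longleftrightarrow> s * m \<le> part P i - a"
    using assms by (simp add: row_length_def less_eq_div_iff_mult_less_eq)
  also have "\<dots> \<longleftrightarrow> a + m * s \<le> part P i"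
  proof -
    have "0 < m * s" using assms by simp
    then show ?thesis by (subst mult.commute) linarith
  qed
  finally show ?thesis using le_part_iff assms by simp
qed

text \<open>The height of the rectangle is the largest \<open>t\<close> with \<open>t \<le> h t\<close>, where \<open>h t\<close> counts the rows of
  length at least \<open>t + \<nu> + 2\<close>; as \<open>h\<close> is decreasing, the rows below the rectangle are shorter than
  its width iff \<open>h\<close> has a fixed point.\<close>

lemma rows_below_durfee_iff:
  assumes "0 < m" "\<forall>x\<in>#P. [x = a] (mod m)"
  shows "(\<forall>i. durfee_height a m \<nu> P < i \<and> i \<le> size P \<longrightarrow>
             row_length a m P i < durfee_height a m \<nu> P + \<nu> + 2) \<longleftrightarrow>
         (\<exists>t. rows_from a m P (a + m * (t + \<nu> + 1)) = t)"
proof -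
  define h where "h t = rows_from a m P (a + m * (t + \<nu> + 1))" for t
  have h: "h t = size {#y \<in># P. a + m * (t + \<nu> + 1) \<le> y#}" for t
    unfolding h_def rows_from_def using assms(2)
    by (intro arg_cong[where f = size] filter_mset_cong) auto
  have h_size: "h t \<le> size P" for t
    unfolding h by (simp add: size_filter_mset_lesseq)
  have anti: "h t \<le> h s" if "s \<le> t" for s t
    unfolding h_def using that by (intro rows_from_antimono) simp
  have row: "t + \<nu> + 2 \<le> row_length a m P i \<longleftrightarrow> i \<le> h t" if "0 < i" "i \<le> size P" for t i
    using le_row_length_iff[OF that \<open>0 < m\<close>, of "t + \<nu> + 1" a] by (simp add: h)
  define T where "T = {t. t \<le> h t}"
  define d where "d = durfee_height a m \<nu> P"
  have "{t. t \<le> size P \<and> (t = 0 \<or> t + \<nu> + 2 \<le> row_length a m P t)} = T"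
    unfolding T_def
  proof (intro Collect_cong)
    fix t
    show "t \<le> size P \<and> (t = 0 \<or> t + \<nu> + 2 \<le> row_length a m P t) \<longleftrightarrow> t \<le> h t"
      using h_size[of t] row[of t t] by (cases "t = 0") auto
  qed
  then have d: "d = Max T" by (simp add: d_def durfee_height_def)
  have "T \<subseteq> {..size P}" using h_size by (auto simp: T_def intro: order_trans)
  then have fin: "finite T" by (rule finite_subset) simp
  have "0 \<in> T" by (simp add: T_def)
  then have "d \<in> T" using d fin by (metis Max_in empty_iff)
  then have dh: "d \<le> h d" by (simp add: T_def)
  have "(\<forall>i. d < i \<and> i \<le> size P \<longrightarrow> row_length a m P i < d + \<nu> + 2) \<longleftrightarrow> h d = d"
  proof
    assume *: "\<forall>i. d < i \<and> i \<le> size P \<longrightarrow> row_length a m P i < d + \<nu> + 2"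
    show "h d = d"
    proof (rule ccontr)
      assume "h d \<noteq> d"
      with dh have "d < h d" by simp
      with * h_size have "row_length a m P (h d) < d + \<nu> + 2" by blast
      with row[of "h d" d] \<open>d < h d\<close> h_size show False by simp
    qed
  next
    assume "h d = d"
    show "\<forall>i. d < i \<and> i \<le> size P \<longrightarrow> row_length a m P i < d + \<nu> + 2"
    proof (intro allI impI)
      fix i assume "d < i \<and> i \<le> size P"
      with row[of i d] \<open>h d = d\<close> show "row_length a m P i < d + \<nu> + 2" by linarith
    qed
  qed
  also have "\<dots> \<longleftrightarrow> (\<exists>t. h t = t)"
  proof
    assume "\<exists>t. h t = t"
    then obtain t where t: "h t = t" by blast
    \<comment> \<open>A fixed point \<open>t\<close> lies in \<open>T\<close>, so
      \<open>t \<le> d\<close>; then \<open>d \<le> h d \<le> h t = t\<close>.\<close>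
    then have "t \<le> d" using d fin by (simp add: T_def)
    from anti[OF this] t dh \<open>t \<le> d\<close> show "h d = d" by simp
  qed blast
  finally show ?thesis by (simp add: d_def h_def)
qed

section \<open>Cutting up the row below the rectangle\<close>

text \<open>The existential expresses the condition below the Durfee rectangle without naming its
  height.\<close>

definition fixed_partitions :: "nat set \<Rightarrow> nat \<Rightarrow> nat \<Rightarrow> nat \<Rightarrow> nat \<Rightarrow> nat multiset set" where
  "fixed_partitions S a m \<nu> n =
     {P \<in> partitions_in S n. (\<forall>j\<le>\<nu>. a + m * j \<in># P) \<and>
        (\<exists>t. rows_from a m P (a + m * (t + \<nu> + 1)) = t)}"

lemma cong_gap:
  fixes x y m :: nat
  assumes "[x = a] (mod m)" "[y = a] (mod m)" "x < y"
  shows "x + m \<le> y"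
proof -
  have "[y = x] (mod m)" using assms by (meson cong_sym cong_trans)
  then have "m dvd y - x" using \<open>x < y\<close> by (metis cong_altdef_nat less_imp_le_nat)
  then have "m \<le> y - x" using \<open>x < y\<close> by (simp add: dvd_imp_le)
  then show ?thesis using \<open>x < y\<close> by simp
qed

lemma cong_row [simp]: "[a + m * j = a] (mod (m::nat))"
  by (simp add: cong_def)

locale modular_rows =
  fixes S :: "nat set" and a m :: nat
  assumes a_pos: "0 < a" and m_pos: "0 < m" and S: "\<And>x. [x = a] (mod m) \<Longrightarrow> x \<in> S"
begin

text \<open>The part whose row has length \<open>size H + \<mu> + 2\<close>, the width of the
  rectangle of height \<open>size H\<close> for parameter \<mu>.\<close>

definition corner :: "nat \<Rightarrow> nat multiset \<Rightarrow> nat" where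
  "corner \<mu> H = a + m * (size H + \<mu> + 1)"

text \<open>\<open>H\<close> holds the rows above the marked row, \<open>L\<close> everything else,
  including the parts outside the class of \<open>a\<close>. The marked row is determined by
  \<open>size H\<close> and \<mu>, so it is not stored, but its weight is counted. Further rows of
  its length may lie in \<open>H\<close> and in \<open>L\<close>.\<close>

definition splittings :: "nat \<Rightarrow> nat \<Rightarrow> (nat multiset \<times> nat multiset) set" where
  "splittings \<mu> n = {(H, L).
     (\<forall>x\<in>#H. [x = a] (mod m) \<and> corner \<mu> H \<le> x) \<and>
     (\<forall>x\<in>#L. 0 < x \<and> x \<in> S \<and> ([x = a] (mod m) \<longrightarrow> x \<le> corner \<mu> H)) \<and>
     (\<forall>j\<le>\<mu>. a + m * j \<in># L) \<and>
     sum_mset H + sum_mset L + corner \<mu> H = n}"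

definition unfixed_partitions :: "nat \<Rightarrow> nat \<Rightarrow> nat multiset set" where
  "unfixed_partitions \<mu> n =
     {P \<in> partitions_in S n. (\<forall>j\<le>\<mu>. a + m * j \<in># P) \<and>
        \<not> (\<exists>t. rows_from a m P (a + m * (t + \<mu> + 1)) = t)}"

definition insert_corner :: "nat \<Rightarrow> nat multiset \<times> nat multiset \<Rightarrow> nat multiset" where
  "insert_corner \<mu> = (\<lambda>(H, L). add_mset (corner \<mu> H) (H + L))"

definition spread_corner :: "nat \<Rightarrow> nat multiset \<times> nat multiset \<Rightarrow> nat multiset" where
  "spread_corner \<mu> = (\<lambda>(H, L). add_mset (a + m * (\<mu> + 1)) (image_mset (\<lambda>x. x + m) H + L))"

lemma corner_cong [simp]: "[corner \<mu> H = a] (mod m)"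
  by (simp only: corner_def cong_row)

text \<open>\<open>H\<close> and the marked row supply \<open>size H + 1\<close> rows of full width;
  one box further only rows of \<open>H\<close> can remain. So the count jumps across the diagonal
  without a fixed point.\<close>

lemma rows_from_insert_corner:
  assumes "(H, L) \<in> splittings \<mu> n"
  shows "size H < rows_from a m (insert_corner \<mu> (H, L)) (a + m * (size H + \<mu> + 1))"
    and "rows_from a m (insert_corner \<mu> (H, L)) (a + m * (Suc (size H) + \<mu> + 1)) \<le> size H"
proof -
  let ?P = "insert_corner \<mu> (H, L)"
  let ?r = "corner \<mu> H"
  have "add_mset ?r H \<subseteq># {#y \<in># ?P. [y = a] (mod m) \<and> ?r \<le> y#}"
  proof -
    have "{#y \<in># H. [y = a] (mod m) \<and> ?r \<le> y#} = H"
      using assms by (subst filter_mset_eq_conv) (auto simp: splittings_def)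
    then show ?thesis by (simp add: insert_corner_def)
  qed
  from size_mset_mono[OF this]
  show "size H < rows_from a m ?P (a + m * (size H + \<mu> + 1))"
    by (simp add: rows_from_def corner_def)
  have r': "a + m * (Suc (size H) + \<mu> + 1) = ?r + m"
    by (simp add: corner_def algebra_simps)
  have "{#y \<in># L. [y = a] (mod m) \<and> ?r + m \<le> y#} = {#}"
    using assms m_pos by (auto simp: splittings_def filter_mset_eq_conv)
  then have "{#y \<in># ?P. [y = a] (mod m) \<and> ?r + m \<le> y#} \<subseteq># H"
    using m_pos by (simp only: insert_corner_def prod.case filter_mset_add_mset filter_union_mset) simp
  from size_mset_mono[OF this]
  show "rows_from a m ?P (a + m * (Suc (size H) + \<mu> + 1)) \<le> size H"
    by (simp only: rows_from_def r')
qed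

text \<open>A decreasing function crosses the diagonal at most once; this lets \<open>size H\<close>
  be read off from the combined partition.\<close>

lemma crossing_unique:
  assumes "\<And>s t. s \<le> t \<Longrightarrow> h t \<le> h s"
    and "t < h t" "h (Suc t) \<le> t" "u < h u" "h (Suc u) \<le> (u::nat)"
  shows "t = (u::nat)"
proof -
  have "\<not> t < u" using assms(1)[of "Suc t" u] assms(3,4) by linarith
  moreover have "\<not> u < t" using assms(1)[of "Suc u" t] assms(2,5) by linarith
  ultimately show ?thesis by simp
qed

lemma inj_on_insert_corner: "inj_on (insert_corner \<mu>) (splittings \<mu> n)"
proof (rule inj_onI, clarify)
  fix H L H' L'
  assume X: "(H, L) \<in> splittings \<mu> n" and X': "(H', L') \<in> splittings \<mu> n"
    and eq: "insert_corner \<mu> (H, L) = insert_corner \<mu> (H', L')"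
  have "size H = size H'"
    by (rule crossing_unique[where h = "\<lambda>t. rows_from a m (insert_corner \<mu> (H, L)) (a + m * (t + \<mu> + 1))"])
      (use rows_from_insert_corner[OF X] rows_from_insert_corner[OF X', folded eq]
        in \<open>auto intro: rows_from_antimono\<close>)
  then have r: "corner \<mu> H' = corner \<mu> H" by (simp add: corner_def)
  let ?r = "corner \<mu> H"
  \<comment> \<open>The upper rows are recovered as all class rows longer than the marked one,
    filled up to the known size with rows of its length.\<close>
  have split: "K = {#y \<in># insert_corner \<mu> (K, J). [y = a] (mod m) \<and> ?r < y#} +
      replicate_mset (size H - size {#y \<in># insert_corner \<mu> (K, J). [y = a] (mod m) \<and> ?r < y#}) ?r"
    if K: "(K, J) \<in> splittings \<mu> n" "size K = size H" for K J
  proof -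
    have rK: "corner \<mu> K = ?r" using K by (simp add: corner_def)
    have "{#y \<in># J. [y = a] (mod m) \<and> ?r < y#} = {#}"
      using K rK by (auto simp: splittings_def filter_mset_eq_conv)
    moreover have "{#y \<in># K. [y = a] (mod m) \<and> ?r < y#} = {#y \<in># K. ?r < y#}"
      using K by (intro filter_mset_cong) (auto simp: splittings_def)
    ultimately have big: "{#y \<in># insert_corner \<mu> (K, J). [y = a] (mod m) \<and> ?r < y#} = {#y \<in># K. ?r < y#}"
      using rK by (simp add: insert_corner_def)
    have part: "K = {#y \<in># K. ?r < y#} + {#y \<in># K. \<not> ?r < y#}"
      by (rule multiset_partition)
    have "y = ?r" if "y \<in># {#y \<in># K. \<not> ?r < y#}" for y
      using that K rK by (fastforce simp: splittings_def)
    then have "{#y \<in># K. \<not> ?r < y#} = replicate_mset (size {#y \<in># K. \<not> ?r < y#}) ?r"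
      by (metis set_mset_subset_singletonD singletonI subsetI)
    moreover have "size {#y \<in># K. \<not> ?r < y#} = size H - size {#y \<in># K. ?r < y#}"
      using part K by (metis add_diff_cancel_left' size_union)
    ultimately show ?thesis using part big by simp
  qed
  have "H = H'"
    using split[OF X] split[OF X'] \<open>size H = size H'\<close> eq by simp
  with eq show "H = H' \<and> L = L'" by (simp add: insert_corner_def)
qed

lemma insert_corner_image: "insert_corner \<mu> ` splittings \<mu> n = unfixed_partitions \<mu> n"
proof (intro equalityI subsetI)
  fix P assume "P \<in> insert_corner \<mu> ` splittings \<mu> n"
  then obtain H L where X: "(H, L) \<in> splittings \<mu> n" and P: "P = insert_corner \<mu> (H, L)" by auto
  have "rows_from a m P (a + m * (t + \<mu> + 1)) \<noteq> t" for t
  proof (cases "t \<le> size H")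
    case True
    then have "rows_from a m P (a + m * (size H + \<mu> + 1)) \<le> rows_from a m P (a + m * (t + \<mu> + 1))"
      by (intro rows_from_antimono) auto
    with rows_from_insert_corner(1)[OF X] True P show ?thesis by simp
  next
    case False
    then have "rows_from a m P (a + m * (t + \<mu> + 1)) \<le> rows_from a m P (a + m * (Suc (size H) + \<mu> + 1))"
      by (intro rows_from_antimono add_mono mult_mono) auto
    with rows_from_insert_corner(2)[OF X] False P show ?thesis by simp
  qed
  moreover have "0 < corner \<mu> H" using a_pos by (simp add: corner_def)
  ultimately show "P \<in> unfixed_partitions \<mu> n"
    using X S P by (auto simp: unfixed_partitions_def splittings_def insert_corner_def partitions_in_iff)
next
  fix P assume P: "P \<in> unfixed_partitions \<mu> n"
  define h where "h t = rows_from a m P (a + m * (t + \<mu> + 1))" for t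
  have "h (size P) \<le> size P"
    unfolding h_def rows_from_def by (simp add: size_filter_mset_lesseq)
  \<comment> \<open>The crossing lies just before the first \<open>s\<close> with
    \<open>h s \<le> s\<close>. This \<open>s\<close> is nonzero as \<open>h 0 \<noteq> 0\<close>,
    and the absence of fixed points sharpens \<open>h (Suc t) \<le> Suc t\<close> to
    \<open>h (Suc t) \<le> t\<close>.\<close>
  then have least: "h (LEAST s. h s \<le> s) \<le> (LEAST s. h s \<le> s)" by (rule LeastI)
  have nfix: "h t \<noteq> t" for t using P by (auto simp: unfixed_partitions_def h_def)
  with least have "(LEAST s. h s \<le> s) \<noteq> 0" by (metis le_zero_eq)
  then obtain t where t: "(LEAST s. h s \<le> s) = Suc t" using not0_implies_Suc by blast
  have ht: "t < h t" using t by (metis lessI not_le not_less_Least)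
  have hs: "h (Suc t) \<le> t" using least nfix[of "Suc t"] t by simp
  define r where "r = a + m * (t + \<mu> + 1)"
  define U where "U = {#y \<in># P. [y = a] (mod m) \<and> r < y#}"
  have r_cong: "[r = a] (mod m)" unfolding r_def by (rule cong_row)
  have U_alt: "U = {#y \<in># P. [y = a] (mod m) \<and> a + m * (Suc t + \<mu> + 1) \<le> y#}"
  proof -
    have "a + m * (Suc t + \<mu> + 1) = r + m" by (simp add: r_def algebra_simps)
    then show ?thesis unfolding U_def \<open>a + m * (Suc t + \<mu> + 1) = r + m\<close>
      using cong_gap[OF r_cong] m_pos by (intro filter_mset_cong) auto
  qed
  then have U_size: "size U = h (Suc t)" by (simp only: h_def rows_from_def)
  have "{#y \<in># P. [y = a] (mod m) \<and> r \<le> y#} = U + replicate_mset (count P r) r"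
    using r_cong by (intro multiset_eqI) (auto simp: U_def)
  then have ht': "h t = size U + count P r" by (simp only: h_def rows_from_def flip: r_def) simp
  \<comment> \<open>\<open>U\<close> has at most \<open>t\<close> rows while more than
    \<open>t\<close> rows reach \<open>r\<close>. So there are enough copies of \<open>r\<close> to
    fill \<open>H\<close> up to size \<open>t\<close> and leave one as the marked row.\<close>
  define H where "H = U + replicate_mset (t - size U) r"
  have H_size: "size H = t" using hs U_size by (simp add: H_def)
  have r_corner: "corner \<mu> H = r" using H_size by (simp add: corner_def r_def)
  have sub: "add_mset r H \<subseteq># P"
  proof (rule mset_subset_eqI)
    fix x
    show "count (add_mset r H) x \<le> count P x"
      using ht ht' hs U_size by (auto simp: H_def U_def)
  qed
  define L where "L = P - add_mset r H"
  have PL: "P = add_mset r (H + L)" using subset_mset.add_diff_inverse[OF sub] by (simp add: L_def)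
  have inP: "\<forall>x\<in>#P. 0 < x \<and> x \<in> S" and sumP: "sum_mset P = n"
    and jP: "\<forall>j\<le>\<mu>. a + m * j \<in># P"
    using P by (auto simp: unfixed_partitions_def partitions_in_iff)
  have "(H, L) \<in> splittings \<mu> n"
    unfolding splittings_def mem_Collect_eq prod.case r_corner
  proof (intro conjI ballI allI impI)
    fix x assume "x \<in># H"
    then show "[x = a] (mod m)" "r \<le> x" using r_cong by (auto simp: H_def U_def split: if_splits)
  next
    fix x assume x: "x \<in># L"
    then show "0 < x" "x \<in> S" using inP by (auto simp: L_def dest: in_diffD)
    assume "[x = a] (mod m)"
    show "x \<le> r"
    proof (rule ccontr)
      assume "\<not> x \<le> r"
      then have "count L x = 0" using \<open>[x = a] (mod m)\<close> by (simp add: L_def H_def U_def)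
      with x show False by (metis not_in_iff)
    qed
  next
    fix j assume j: "j \<le> \<mu>"
    then have "m * j < m * (t + \<mu> + 1)" using m_pos by (intro mult_strict_left_mono) auto
    then have "a + m * j < r" by (simp add: r_def)
    then have "a + m * j \<notin># add_mset r H" by (auto simp: H_def U_def split: if_splits)
    then show "a + m * j \<in># L" using jP j by (auto simp: PL)
  next
    show "sum_mset H + sum_mset L + r = n" using sumP PL by simp
  qed
  moreover have "P = insert_corner \<mu> (H, L)" using PL r_corner by (simp add: insert_corner_def)
  ultimately show "P \<in> insert_corner \<mu> ` splittings \<mu> n" by blast
qed

text \<open>Lengthened rows of \<open>H\<close> reach one box beyond the marked row, but neither the
  class rows of \<open>L\<close> nor the inserted row do. Hence \<open>size H\<close> is a fixed
  point for \<open>Suc \<mu>\<close>.\<close>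

lemma spread_corner_rows:
  assumes "(H, L) \<in> splittings \<mu> n"
  shows "{#y \<in># spread_corner \<mu> (H, L). [y = a] (mod m) \<and> a + m * (size H + Suc \<mu> + 1) \<le> y#} =
    image_mset (\<lambda>x. x + m) H"
proof -
  let ?r = "corner \<mu> H"
  have r': "a + m * (size H + Suc \<mu> + 1) = ?r + m"
    by (simp add: corner_def algebra_simps)
  have "{#y \<in># L. [y = a] (mod m) \<and> ?r + m \<le> y#} = {#}"
    using assms m_pos by (auto simp: splittings_def filter_mset_eq_conv)
  moreover have "{#y \<in># image_mset (\<lambda>x. x + m) H. [y = a] (mod m) \<and> ?r + m \<le> y#} = image_mset (\<lambda>x. x + m) H"
    using assms by (subst filter_mset_eq_conv) (auto simp: splittings_def cong_def)
  moreover have "a + m * (\<mu> + 1) < ?r + m"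
    using m_pos by (simp add: corner_def algebra_simps)
  ultimately show ?thesis
    unfolding r' by (simp add: spread_corner_def)
qed

lemma inj_on_spread_corner: "inj_on (spread_corner \<mu>) (splittings \<mu> n)"
proof (rule inj_onI, clarify)
  fix H L H' L'
  assume X: "(H, L) \<in> splittings \<mu> n" and X': "(H', L') \<in> splittings \<mu> n"
    and eq: "spread_corner \<mu> (H, L) = spread_corner \<mu> (H', L')"
  define h where "h t = rows_from a m (spread_corner \<mu> (H, L)) (a + m * (t + Suc \<mu> + 1))" for t
  have anti: "h t \<le> h s" if "s \<le> t" for s t
    unfolding h_def using that by (intro rows_from_antimono) simp
  have "h (size H) = size H" "h (size H') = size H'"
    using spread_corner_rows[OF X] spread_corner_rows[OF X'] eq
    by (simp_all only: h_def rows_from_def size_image_mset)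
  \<comment> \<open>A decreasing function has at most one fixed point.\<close>
  then have sz: "size H = size H'"
    using anti by (metis le_antisym nat_le_linear)
  then have "image_mset (\<lambda>x. x + m) H = image_mset (\<lambda>x. x + m) H'"
    using spread_corner_rows[OF X] spread_corner_rows[OF X'] eq by simp
  then have "H = H'"
    by (rule multiset.inj_map_strong[rotated]) simp
  with eq show "H = H' \<and> L = L'" by (simp add: spread_corner_def)
qed

lemma spread_corner_image: "spread_corner \<mu> ` splittings \<mu> n = fixed_partitions S a m (Suc \<mu>) n"
proof (intro equalityI subsetI)
  fix P assume "P \<in> spread_corner \<mu> ` splittings \<mu> n"
  then obtain H L where X: "(H, L) \<in> splittings \<mu> n" and P: "P = spread_corner \<mu> (H, L)" by auto
  have fixp: "rows_from a m P (a + m * (size H + Suc \<mu> + 1)) = size H"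
    using spread_corner_rows[OF X] P by (simp only: rows_from_def size_image_mset)
  have "0 < x \<and> x \<in> S" if "x \<in># P" for x
  proof -
    consider "x = a + m * (\<mu> + 1)" | y where "y \<in># H" "x = y + m" | "x \<in># L"
      using \<open>x \<in># P\<close> by (auto simp: P spread_corner_def)
    then show ?thesis
    proof cases
      case 1
      then show ?thesis using S[OF cong_row, of "\<mu> + 1"] a_pos by simp
    next
      case 2
      then have "[x = a] (mod m)" using X by (auto simp: splittings_def cong_def)
      then show ?thesis using 2 S m_pos by simp
    qed (use X in \<open>auto simp: splittings_def\<close>)
  qed
  \<comment> \<open>The added boxes and the inserted row together weigh as much as the deleted
    marked row.\<close>
  moreover have "sum_mset (image_mset (\<lambda>x. x + m) H) = sum_mset H + size H * m"
    by (induction H) auto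
  then have "sum_mset P = n"
    using X by (simp add: P spread_corner_def splittings_def corner_def algebra_simps)
  moreover have "a + m * j \<in># P" if "j \<le> Suc \<mu>" for j
    using that X by (cases "j = Suc \<mu>") (auto simp: P spread_corner_def splittings_def)
  ultimately show "P \<in> fixed_partitions S a m (Suc \<mu>) n"
    unfolding fixed_partitions_def partitions_in_iff using fixp by blast
next
  fix P assume P: "P \<in> fixed_partitions S a m (Suc \<mu>) n"
  then obtain t where t: "rows_from a m P (a + m * (t + Suc \<mu> + 1)) = t"
    by (auto simp: fixed_partitions_def)
  define r where "r = a + m * (t + \<mu> + 1)"
  have r': "a + m * (t + Suc \<mu> + 1) = r + m" by (simp add: r_def algebra_simps)
  have r_cong: "[r = a] (mod m)" unfolding r_def by (rule cong_row)
  \<comment> \<open>The fixed point says exactly that \<open>U\<close> has \<open>t\<close> rows;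
    each loses one box, and the row \<open>b\<close> is removed from the rest.\<close>
  define U where "U = {#y \<in># P. [y = a] (mod m) \<and> r + m \<le> y#}"
  define V where "V = {#y \<in># P. \<not> ([y = a] (mod m) \<and> r + m \<le> y)#}"
  define b where "b = a + m * (\<mu> + 1)"
  define H where "H = image_mset (\<lambda>x. x - m) U"
  define L where "L = V - {#b#}"
  have PUV: "P = U + V" unfolding U_def V_def by (rule multiset_partition)
  have inP: "\<forall>x\<in>#P. 0 < x \<and> x \<in> S" and sumP: "sum_mset P = n"
    and jP: "\<forall>j\<le>Suc \<mu>. a + m * j \<in># P"
    using P by (auto simp: fixed_partitions_def partitions_in_iff)
  have H_size: "size H = t" using t unfolding H_def U_def rows_from_def r' by simp
  have r_corner: "corner \<mu> H = r" using H_size by (simp add: corner_def r_def)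
  have UH: "U = image_mset (\<lambda>x. x + m) H"
    unfolding H_def by (simp add: multiset.map_comp comp_def)
      (rule sym, rule multiset.map_ident_strong, auto simp: U_def)
  have low: "a + m * j \<in># V" if "j \<le> Suc \<mu>" for j
  proof -
    have "m * j \<le> m * (t + \<mu> + 1)" using that by (intro mult_le_mono) auto
    then have "a + m * j < r + m" using m_pos by (simp add: r_def)
    then show ?thesis using jP that by (simp add: V_def)
  qed
  have VL: "V = add_mset b L" using low[of "Suc \<mu>"] by (simp add: L_def b_def)
  have "(H, L) \<in> splittings \<mu> n"
    unfolding splittings_def mem_Collect_eq prod.case r_corner
  proof (intro conjI ballI allI impI)
    fix x assume "x \<in># H"
    then have "x + m \<in># U" using UH by simp
    then show "[x = a] (mod m)" "r \<le> x" by (auto simp: U_def cong_def)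
  next
    fix x assume x: "x \<in># L"
    then have xV: "x \<in># V" by (auto simp: L_def dest: in_diffD)
    then show "0 < x" "x \<in> S" using inP by (auto simp: V_def)
    assume "[x = a] (mod m)"
    then show "x \<le> r" using xV cong_gap[OF r_cong, of x] m_pos by (cases "r < x") (auto simp: V_def)
  next
    fix j assume j: "j \<le> \<mu>"
    then have "m * j < m * (\<mu> + 1)" using m_pos by (intro mult_strict_left_mono) auto
    then have "a + m * j \<noteq> b" by (simp add: b_def)
    then show "a + m * j \<in># L" using low[of j] j VL by simp
  next
    have "sum_mset U = sum_mset H + size H * m"
      unfolding UH by (induction H) auto
    then show "sum_mset H + sum_mset L + r = n"
      using sumP PUV VL H_size by (simp add: r_def b_def algebra_simps)
  qed
  moreover have "P = spread_corner \<mu> (H, L)" using PUV VL UH by (simp add: spread_corner_def b_def)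
  ultimately show "P \<in> spread_corner \<mu> ` splittings \<mu> n" by blast
qed

text \<open>Both sides are parametrised by a partition with a marked row of length \<open>t + \<mu> + 2\<close> below the
  \<open>t\<close> longest rows \<open>H\<close>: deleting that row, lengthening the rows of \<open>H\<close> by one box each and inserting
  a row of length \<open>\<mu> + 2\<close> preserves the weight.\<close>

lemma card_unfixed_partitions: "card (unfixed_partitions \<mu> n) = card (fixed_partitions S a m (Suc \<mu>) n)"
  by (metis card_image inj_on_insert_corner inj_on_spread_corner insert_corner_image spread_corner_image)

end

section \<open>The Jacobi triple product\<close>

text \<open>The q-Pochhammer symbol (Q; Q)_n.\<close>

definition qfact :: "'a :: comm_ring_1 \<Rightarrow> nat \<Rightarrow> 'a" where
  "qfact Q n = (\<Prod>k<n. 1 - Q ^ Suc k)"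

text \<open>\<open>gauss_binom Q i j\<close> is the Gaussian binomial coefficient usually indexed by \<open>i + j\<close> and \<open>j\<close>.\<close>

fun gauss_binom :: "'a :: comm_ring_1 \<Rightarrow> nat \<Rightarrow> nat \<Rightarrow> 'a" where
  "gauss_binom Q 0 j = 1"
| "gauss_binom Q (Suc i) 0 = 1"
| "gauss_binom Q (Suc i) (Suc j) = gauss_binom Q (Suc i) j + Q ^ Suc j * gauss_binom Q i (Suc j)"

lemma gauss_binom_0_right [simp]: "gauss_binom Q i 0 = 1"
  by (cases i) auto

lemma qfact_Suc: "qfact Q (Suc n) = qfact Q n * (1 - Q ^ Suc n)"
  by (simp add: qfact_def)

text \<open>By the Pascal rule the induction reduces to
  \<open>(1 - Q^(j+1)) + Q^(j+1) * (1 - Q^(i+1)) = 1 - Q^(i+j+2)\<close>. Clearing denominators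
  makes the quotient formula valid in any commutative ring.\<close>

lemma qfact_gauss_binom: "qfact Q i * qfact Q j * gauss_binom Q i j = qfact Q (i + j)"
proof (induction Q i j rule: gauss_binom.induct)
  case (3 Q i j)
  have "qfact Q (Suc i) * qfact Q (Suc j) * gauss_binom Q (Suc i) (Suc j) =
      (1 - Q ^ Suc j) * (qfact Q (Suc i) * qfact Q j * gauss_binom Q (Suc i) j) +
      Q ^ Suc j * (1 - Q ^ Suc i) * (qfact Q i * qfact Q (Suc j) * gauss_binom Q i (Suc j))"
    unfolding gauss_binom.simps qfact_Suc by (simp only: algebra_simps)
  also have "\<dots> = ((1 - Q ^ Suc j) + Q ^ Suc j * (1 - Q ^ Suc i)) * qfact Q (Suc i + j)"
    unfolding 3 by (simp add: algebra_simps)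
  also have "\<dots> = qfact Q (Suc i + Suc j)"
    by (simp add: qfact_Suc algebra_simps power_add)
  finally show ?case .
qed (auto simp: qfact_def)

lemma Suc_choose_two: "Suc j choose 2 = (j choose 2) + j"
  by (simp add: numeral_2_eq_2)

text \<open>Splitting off the factor \<open>k = 0\<close> leaves the product for
  \<open>x * Q\<close>, hence the induction over arbitrary \<open>x\<close>. The homogeneous form
  avoids negative powers of \<open>q\<close> in the later substitution.\<close>

lemma gauss_binomial_theorem:
  "(\<Prod>k<N. y - x * Q ^ k) =
     (\<Sum>j\<le>N. (- 1) ^ j * Q ^ (j choose 2) * gauss_binom Q (N - j) j * x ^ j * y ^ (N - j))"
proof (induction N arbitrary: x)
  case (Suc N)
  define T where "T j = (- 1) ^ j * Q ^ (j choose 2) * gauss_binom Q (N - j) j * (x * Q) ^ j * y ^ (N - j)" for j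
  define T' where "T' j = (- 1) ^ j * Q ^ (j choose 2) * gauss_binom Q (Suc N - j) j * x ^ j * y ^ (Suc N - j)" for j
  \<comment> \<open>The Pascal rule for coefficients. At \<open>j = N\<close> the second term is
    dropped explicitly: the truncated \<open>N - Suc N\<close> would not make
    \<open>T (Suc N)\<close> vanish.\<close>
  have step: "T' (Suc j) = - x * T j + (if j < N then y * T (Suc j) else 0)" if "j \<le> N" for j
  proof (cases "j < N")
    case True
    then obtain i where i: "N = Suc i + j" by (metis add.commute add_Suc_right less_natE)
    then show ?thesis
      by (simp add: T_def T'_def Suc_choose_two power_mult_distrib power_add algebra_simps)
  next
    case False
    with that have "j = N" by simp
    then show ?thesis
      by (simp add: T_def T'_def Suc_choose_two power_mult_distrib power_add algebra_simps)
  qed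
  have "(\<Prod>k<Suc N. y - x * Q ^ k) = (y - x) * (\<Prod>k<N. y - (x * Q) * Q ^ k)"
    by (simp add: prod.lessThan_Suc_shift mult.assoc del: prod.lessThan_Suc)
  also have "(\<Prod>k<N. y - (x * Q) * Q ^ k) = sum T {..N}"
    unfolding T_def by (rule Suc.IH)
  also have "(y - x) * sum T {..N} = y * sum T {..N} + (\<Sum>j\<le>N. - x * T j)"
    by (simp add: left_diff_distrib sum_negf flip: sum_distrib_left)
  also have "y * sum T {..N} = y * T 0 + (\<Sum>j<N. y * T (Suc j))"
    by (simp add: sum_distrib_left sum.atMost_shift distrib_left)
  also have "(\<Sum>j<N. y * T (Suc j)) = (\<Sum>j\<le>N. if j < N then y * T (Suc j) else 0)"
    by (rule sum.mono_neutral_cong_left) auto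
  also have "y * T 0 = T' 0" by (simp add: T_def T'_def)
  also have "T' 0 + (\<Sum>j\<le>N. if j < N then y * T (Suc j) else 0) + (\<Sum>j\<le>N. - x * T j) =
      T' 0 + (\<Sum>j\<le>N. T' (Suc j))"
    unfolding add.assoc sum.distrib[symmetric]
    by (intro arg_cong2[where f = plus] sum.cong refl) (simp add: step)
  also have "\<dots> = sum T' {..Suc N}"
    by (simp add: sum.atMost_Suc_shift del: sum.atMost_Suc)
  finally show ?case by (simp add: T'_def)
qed (simp add: numeral_2_eq_2)

lemma sum_centered:
  fixes f :: "nat \<Rightarrow> 'a :: comm_monoid_add"
  shows "(\<Sum>j\<le>N + N. f j) = f N + (\<Sum>k=1..N. f (N + k) + f (N - k))"
proof -
  have "(\<Sum>j=N - M..N + M. f j) = f N + (\<Sum>k=1..M. f (N + k) + f (N - k))" if "M \<le> N" for M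
    using that
  proof (induction M)
    case (Suc M)
    then have "{N - Suc M..N + Suc M} = insert (N - Suc M) (insert (N + Suc M) {N - M..N + M})"
      by auto
    then have "(\<Sum>j=N - Suc M..N + Suc M. f j) = f (N - Suc M) + (f (N + Suc M) + (\<Sum>j=N - M..N + M. f j))"
      using Suc.prems by (simp del: add_Suc_right, subst sum.insert) auto
    with Suc show ?case by (simp add: add_ac)
  qed simp
  from this[of N] show ?thesis by (simp add: atLeast0AtMost)
qed

lemma prod_lessThan_add:
  fixes f :: "nat \<Rightarrow> 'a :: comm_monoid_mult"
  shows "(\<Prod>i<N + M. f i) = (\<Prod>i<N. f i) * (\<Prod>i<M. f (N + i))"
  by (induction M) (auto simp: mult.assoc)

text \<open>Obtained from the \<open>q\<close>-binomial theorem with \<open>Q = q^4\<close>, \<open>x = q\<close> and \<open>y = q^(4*N)\<close>.\<close>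

lemma finite_triple_product:
  fixes q :: "'a :: idom"
  assumes "q \<noteq> 0"
  shows "(\<Prod>i<N. (1 - q ^ (4 * i + 1)) * (1 - q ^ (4 * i + 3))) =
    gauss_binom (q ^ 4) N N +
    (\<Sum>k=1..N. (- 1) ^ k * (q ^ (k * (2 * k - 1)) * gauss_binom (q ^ 4) (N - k) (N + k) +
                            q ^ (k * (2 * k + 1)) * gauss_binom (q ^ 4) (N + k) (N - k)))"
proof -
  \<comment> \<open>\<open>t j\<close> is \<open>j * (2 * j - 1)\<close>, the exponent of
    \<open>q\<close> in \<open>Q^(j choose 2) * x^j\<close>.\<close>
  define t where "t j = 4 * (j choose 2) + j" for j :: nat
  have t_0: "t 0 = 0" by (simp add: t_def numeral_2_eq_2)
  have t_Suc: "t (Suc j) = t j + (4 * j + 1)" for j by (simp add: t_def Suc_choose_two)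
  have t: "t j + j = 2 * j * j" for j
    by (induction j) (auto simp: t_0 t_Suc)
  \<comment> \<open>The exponent of \<open>q\<close> at the central index \<open>j = N\<close>; all
    terms share the factor \<open>(-1)^N * q^C\<close>.\<close>
  define C where "C = t N + 4 * N * N"
  define f where "f j = (- 1) ^ j * (q ^ 4) ^ (j choose 2) * gauss_binom (q ^ 4) (N + N - j) j *
      q ^ j * (q ^ (4 * N)) ^ (N + N - j)" for j
  have f_alt: "f j = (- 1) ^ j * gauss_binom (q ^ 4) (N + N - j) j * q ^ (t j + 4 * N * (N + N - j))" for j
    unfolding f_def t_def power_mult[symmetric] power_add by (simp only: mult_ac)
  have f_N: "f N = (- 1) ^ N * q ^ C * gauss_binom (q ^ 4) N N"
    by (simp add: f_alt C_def)
  have f_plus: "f (N + k) = (- 1) ^ N * q ^ C * ((- 1) ^ k * (q ^ (k * (2 * k - 1)) * gauss_binom (q ^ 4) (N - k) (N + k)))"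
    if k: "k \<le> N" for k
  proof -
    obtain d where d: "N = k + d" using k unfolding le_iff_add by blast
    have "k * (2 * k - 1) + k = 2 * k * k" by (cases k) auto
    with t[of k] have "k * (2 * k - 1) = t k" by simp
    moreover have "t (N + k) + 4 * N * (N - k) = C + t k"
      using t[of "N + k"] t[of N] t[of k] by (simp add: C_def d algebra_simps)
    ultimately show ?thesis by (simp add: f_alt power_add)
  qed
  have f_minus: "f (N - k) = (- 1) ^ N * q ^ C * ((- 1) ^ k * (q ^ (k * (2 * k + 1)) * gauss_binom (q ^ 4) (N + k) (N - k)))"
    if k: "k \<le> N" for k
  proof -
    obtain d where d: "N = k + d" using k unfolding le_iff_add by blast
    have "t (N - k) + 4 * N * (N + k) = C + k * (2 * k + 1)"
      using t[of "N - k"] t[of N] by (simp add: C_def d algebra_simps)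
    moreover have "(- 1 :: 'a) ^ (N - k) = (- 1) ^ N * (- 1) ^ k"
      by (simp add: d power_add flip: power_mult_distrib)
    moreover have "N + N - (N - k) = N + k" using k by simp
    ultimately show ?thesis by (simp add: f_alt power_add)
  qed
  \<comment> \<open>From the first \<open>N\<close> factors \<open>-q^(4 * i + 1)\<close> is taken
    out; the remaining exponents 3, 7, ... appear in reverse order.\<close>
  have "(\<Prod>i<N. q ^ (4 * N) - q * (q ^ 4) ^ i) =
      (\<Prod>i<N. (- 1) * q ^ (4 * i + 1) * (1 - q ^ (4 * (N - Suc i) + 3)))"
  proof (intro prod.cong refl)
    fix i assume "i \<in> {..<N}"
    then have "4 * N = (4 * i + 1) + (4 * (N - Suc i) + 3)" by auto
    then have "q ^ (4 * N) = q ^ (4 * i + 1) * q ^ (4 * (N - Suc i) + 3)" by (metis power_add)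
    moreover have "q * (q ^ 4) ^ i = q ^ (4 * i + 1)" by (simp add: power_mult)
    ultimately show "q ^ (4 * N) - q * (q ^ 4) ^ i = (- 1) * q ^ (4 * i + 1) * (1 - q ^ (4 * (N - Suc i) + 3))"
      by (simp only: right_diff_distrib mult_minus_left mult_1_left mult_1_right diff_minus_eq_add uminus_add_conv_diff)
  qed
  also have "\<dots> = (- 1) ^ N * (\<Prod>i<N. q ^ (4 * i + 1)) * (\<Prod>i<N. 1 - q ^ (4 * i + 3))"
    using prod.nat_diff_reindex[of "\<lambda>i. 1 - q ^ (4 * i + 3)" N]
    by (simp only: prod.distrib prod_constant card_lessThan)
  also have "(\<Prod>i<N. q ^ (4 * i + 1)) = q ^ t N"
    by (induction N) (simp_all only: t_0 t_Suc power_add prod.lessThan_Suc lessThan_0 prod.empty power_0)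
  finally have low: "(\<Prod>i<N. q ^ (4 * N) - q * (q ^ 4) ^ i) = (- 1) ^ N * q ^ t N * (\<Prod>i<N. 1 - q ^ (4 * i + 3))" .
  have "(\<Prod>i<N. q ^ (4 * N) - q * (q ^ 4) ^ (N + i)) = (\<Prod>i<N. q ^ (4 * N) * (1 - q ^ (4 * i + 1)))"
    by (intro prod.cong refl) (simp add: algebra_simps power_add flip: power_mult)
  also have "\<dots> = q ^ (4 * N * N) * (\<Prod>i<N. 1 - q ^ (4 * i + 1))"
    by (simp add: prod.distrib flip: power_mult)
  finally have high: "(\<Prod>i<N. q ^ (4 * N) - q * (q ^ 4) ^ (N + i)) = q ^ (4 * N * N) * (\<Prod>i<N. 1 - q ^ (4 * i + 1))" .
  have "(- 1) ^ N * q ^ C * (\<Prod>i<N. (1 - q ^ (4 * i + 1)) * (1 - q ^ (4 * i + 3))) =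
      (\<Prod>i<N + N. q ^ (4 * N) - q * (q ^ 4) ^ i)"
    unfolding prod_lessThan_add low high C_def power_add[of q "t N"] prod.distrib
    by (simp only: mult_ac)
  also have "\<dots> = (\<Sum>j\<le>N + N. f j)"
    unfolding f_def by (rule gauss_binomial_theorem)
  also have "\<dots> = f N + (\<Sum>k=1..N. f (N + k) + f (N - k))"
    by (rule sum_centered)
  also have "(\<Sum>k=1..N. f (N + k) + f (N - k)) = (- 1) ^ N * q ^ C *
      (\<Sum>k=1..N. (- 1) ^ k * (q ^ (k * (2 * k - 1)) * gauss_binom (q ^ 4) (N - k) (N + k) +
                            q ^ (k * (2 * k + 1)) * gauss_binom (q ^ 4) (N + k) (N - k)))"
    unfolding sum_distrib_left by (intro sum.cong refl) (simp add: f_plus f_minus distrib_left)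
  finally have "(- 1) ^ N * q ^ C * (\<Prod>i<N. (1 - q ^ (4 * i + 1)) * (1 - q ^ (4 * i + 3))) =
     (- 1) ^ N * q ^ C * (gauss_binom (q ^ 4) N N +
      (\<Sum>k=1..N. (- 1) ^ k * (q ^ (k * (2 * k - 1)) * gauss_binom (q ^ 4) (N - k) (N + k) +
                            q ^ (k * (2 * k + 1)) * gauss_binom (q ^ 4) (N + k) (N - k))))"
    by (simp only: f_N distrib_left)
  moreover have "(- 1) ^ N * q ^ C \<noteq> 0" using assms by simp
  ultimately show ?thesis using mult_left_cancel by fast
qed

section \<open>Limits as congruences modulo powers of \<open>fps_X\<close>\<close>

lemma fps_X_power_dvd_iff:
  fixes f :: "'a :: comm_ring_1 fps"
  shows "fps_X ^ n dvd f \<longleftrightarrow> (\<forall>i<n. fps_nth f i = 0)"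
proof
  assume "\<forall>i<n. fps_nth f i = 0"
  then have "f = fps_X ^ n * fps_shift n f"
    by (intro fps_ext) (auto simp: fps_X_power_mult_nth)
  then show "fps_X ^ n dvd f" by (rule dvdI)
qed (auto simp: dvd_def fps_X_power_mult_nth)

lemma qfact_fps_stable:
  fixes M i j :: nat
  assumes "M \<le> i" "M \<le> j"
  shows "fps_X ^ M dvd qfact (fps_X ^ 4 :: int fps) i - qfact (fps_X ^ 4) j"
proof -
  have *: "fps_X ^ M dvd qfact (fps_X ^ 4 :: int fps) (M + d) - qfact (fps_X ^ 4) M" for d
  proof (induction d)
    case (Suc d)
    have "(fps_X :: int fps) ^ M dvd (fps_X ^ 4) ^ Suc (M + d)"
      unfolding power_mult[symmetric] by (rule le_imp_power_dvd) simp
    then have "fps_X ^ M dvd (qfact (fps_X ^ 4 :: int fps) (M + d) - qfact (fps_X ^ 4) M) -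
        qfact (fps_X ^ 4) (M + d) * (fps_X ^ 4) ^ Suc (M + d)"
      using Suc by (intro dvd_diff[OF _ dvd_mult])
    then show ?case by (simp add: qfact_Suc right_diff_distrib algebra_simps)
  qed simp
  from dvd_diff[OF *[of "i - M"] *[of "j - M"]] assms show ?thesis by simp
qed

text \<open>Modulo \<open>fps_X^M\<close> all \<open>qfact\<close> values involved agree with the
  one at \<open>M\<close>, which is invertible because its constant term is 1.\<close>

lemma qfact_gauss_binom_fps:
  assumes "M \<le> i" "M \<le> j" "M \<le> N"
  shows "fps_X ^ M dvd qfact (fps_X ^ 4 :: int fps) N * gauss_binom (fps_X ^ 4) i j - 1"
proof -
  let ?q = "qfact (fps_X ^ 4 :: int fps)" and ?g = "gauss_binom (fps_X ^ 4 :: int fps) i j"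
  have "?q M * (?q N * ?g - 1) = ?g * (?q M * (?q N - ?q j) + ?q j * (?q M - ?q i)) +
      (?q i * ?q j * ?g - ?q M)"
    by (simp add: algebra_simps)
  also have "?q i * ?q j * ?g = ?q (i + j)" by (rule qfact_gauss_binom)
  finally have "fps_X ^ M dvd ?q M * (?q N * ?g - 1)"
    using assms by (simp add: dvd_add dvd_mult qfact_fps_stable)
  then have "fps_X ^ M dvd fps_right_inverse (?q M) 1 * (?q M * (?q N * ?g - 1))"
    by (rule dvd_mult)
  moreover have "fps_nth (?q M) 0 * 1 = 1"
    by (induction M) (simp_all add: qfact_def flip: power_mult)
  from fps_right_inverse[OF this] have "fps_right_inverse (?q M) 1 * (?q M * (?q N * ?g - 1)) = ?q N * ?g - 1"
    by (simp only: mult.assoc[symmetric] mult.commute[of "fps_right_inverse (?q M) 1"] mult_1)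
  ultimately show ?thesis by simp
qed

section \<open>Generating functions of partitions\<close>

definition partitions_fps :: "nat set \<Rightarrow> int fps" where
  "partitions_fps S = Abs_fps (\<lambda>n. int (card (partitions_in S n)))"

text \<open>Multiplying by \<open>1 - fps_X^s\<close> subtracts the partitions containing
  \<open>s\<close>. Removing parts one at a time avoids infinite products.\<close>

lemma partitions_fps_remove:
  assumes "s \<in> S" "0 < s"
  shows "partitions_fps S * (1 - fps_X ^ s) = partitions_fps (S - {s})"
proof (rule fps_ext)
  fix n
  have "partitions_in S n = {P \<in> partitions_in S n. {#s#} \<subseteq># P} \<union> partitions_in (S - {s}) n"
    by (auto simp: partitions_in_iff)
  moreover have "{P \<in> partitions_in S n. {#s#} \<subseteq># P} \<inter> partitions_in (S - {s}) n = {}"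
    by (auto simp: partitions_in_iff)
  ultimately have "card (partitions_in S n) =
      card {P \<in> partitions_in S n. {#s#} \<subseteq># P} + card (partitions_in (S - {s}) n)"
    by (metis (no_types, lifting) card_Un_disjoint finite_Un finite_partitions_in)
  then show "fps_nth (partitions_fps S * (1 - fps_X ^ s)) n = fps_nth (partitions_fps (S - {s})) n"
    using assms card_partitions_in_containing[of "{#s#}" S n]
    by (auto simp: partitions_fps_def right_diff_distrib fps_X_power_mult_right_nth)
qed

lemma partitions_fps_remove_finite:
  assumes "finite F" "F \<subseteq> S" "0 \<notin> F"
  shows "partitions_fps S * (\<Prod>s\<in>F. 1 - fps_X ^ s) = partitions_fps (S - F)"
  using assms
proof (induction F rule: finite_induct)
  case (insert s F)
  then have "partitions_fps S * (\<Prod>s\<in>insert s F. 1 - fps_X ^ s) =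
      partitions_fps (S - F) * (1 - fps_X ^ s)"
    by (simp add: mult_ac)
  also have "\<dots> = partitions_fps (S - F - {s})"
    using insert by (intro partitions_fps_remove) auto
  also have "S - F - {s} = S - insert s F" by blast
  finally show ?case .
qed simp

text \<open>Up to degree \<open>n\<close> only the empty partition is left. The case
  \<open>s = 0\<close> is allowed because 0 lies in \<open>parts24\<close>, though it is never a
  part.\<close>

lemma partitions_fps_large_parts:
  assumes "\<forall>s\<in>S. s = 0 \<or> n < s"
  shows "fps_X ^ Suc n dvd partitions_fps S - 1"
  unfolding fps_X_power_dvd_iff
proof (intro allI impI)
  fix i assume i: "i < Suc n"
  show "fps_nth (partitions_fps S - 1) i = 0"
  proof (cases "i = 0")
    case True
    have "partitions_in S 0 = {{#}}"
    proof (intro equalityI subsetI)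
      fix P assume P: "P \<in> partitions_in S 0"
      then have "size P \<le> 0" using size_le_sum_mset[of P] by (metis partitions_in_iff)
      then show "P \<in> {{#}}" by simp
    qed (simp add: partitions_in_iff)
    with True show ?thesis by (simp add: partitions_fps_def)
  next
    case False
    have "partitions_in S i = {}"
    proof (safe, goal_cases)
      case (1 P)
      then have "P \<noteq> {#}" using False by (auto simp: partitions_in_iff)
      then obtain x where x: "x \<in># P" by blast
      then have "x \<le> i" using 1 by (auto simp: partitions_in_iff dest: multi_member_split)
      moreover have "n < x" using x 1 assms by (fastforce simp: partitions_in_iff)
      ultimately show ?case using i by simp
    qed
    with False show ?thesis by (simp add: partitions_fps_def)
  qed
qed

abbreviation parts24 :: "nat set" where "parts24 \<equiv> {x. \<not> [x = 2] (mod 4)}"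

lemma prod_parts24:
  "(\<Prod>s\<in>{1..4 * N} \<inter> parts24. 1 - fps_X ^ s) =
     (\<Prod>i<N. (1 - fps_X ^ (4 * i + 1)) * (1 - fps_X ^ (4 * i + 3))) * qfact (fps_X ^ 4 :: int fps) N"
proof (induction N)
  case (Suc N)
  have "{1..4 * Suc N} \<inter> parts24 = {4 * N + 1, 4 * N + 3, 4 * N + 4} \<union> ({1..4 * N} \<inter> parts24)"
    unfolding cong_def by auto presburger+
  also have "(\<Prod>s\<in>\<dots>. 1 - fps_X ^ s) = (\<Prod>s\<in>{4 * N + 1, 4 * N + 3, 4 * N + 4}. 1 - fps_X ^ s) *
      (\<Prod>s\<in>{1..4 * N} \<inter> parts24. 1 - fps_X ^ s :: int fps)"
    by (rule prod.union_disjoint) auto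
  also have "(\<Prod>s\<in>{4 * N + 1, 4 * N + 3, 4 * N + 4}. 1 - fps_X ^ s :: int fps) =
      (1 - fps_X ^ (4 * N + 1)) * (1 - fps_X ^ (4 * N + 3)) * (1 - (fps_X ^ 4) ^ Suc N)"
    by (simp add: mult.assoc flip: power_mult power_add)
  finally show ?case
    unfolding Suc by (simp only: qfact_Suc prod.lessThan_Suc mult_ac)
qed (simp add: qfact_def)

text \<open>Without the guard, truncated subtraction would give \<open>p24 0 = 1\<close> for
  \<open>e > n\<close>.\<close>

definition shifted_count :: "nat \<Rightarrow> nat \<Rightarrow> nat" where
  "shifted_count n e = (if e \<le> n then p24 (n - e) else 0)"

lemma p24_eq: "p24 n = card (partitions_in parts24 n)"
  unfolding p24_def partitions_in_def by (rule arg_cong[where f = card]) auto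

text \<open>Modulo \<open>fps_X^(n+1)\<close> the generating function of \<open>p24\<close> is
  inverse to the truncated theta series \<open>J\<close>, so the product has no term of positive
  degree \<open>n\<close>.\<close>

lemma triple_product_recurrence:
  assumes "0 < n"
  shows "int (p24 n) + (\<Sum>k=1..2 * n + 1. (- 1) ^ k *
    (int (shifted_count n (k * (2 * k - 1))) + int (shifted_count n (k * (2 * k + 1))))) = 0"
proof -
  \<comment> \<open>Every \<open>k \<le> N\<close> satisfies \<open>n < k\<close> or
    \<open>n < N - k\<close>: either the power of \<open>fps_X\<close> vanishes modulo
    \<open>fps_X^(n+1)\<close>, or the Gaussian binomial times \<open>?q N\<close> is 1.\<close>
  define N where "N = 2 * n + 1"
  let ?X = "fps_X :: int fps" and ?q = "qfact (fps_X ^ 4 :: int fps)"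
    and ?g = "gauss_binom (fps_X ^ 4 :: int fps)" and ?A = "partitions_fps parts24"
  define A where "A = (\<Prod>i<N. (1 - ?X ^ (4 * i + 1)) * (1 - ?X ^ (4 * i + 3)))"
  define J where "J = 1 + (\<Sum>k=1..N. (- 1) ^ k * (?X ^ (k * (2 * k - 1)) + ?X ^ (k * (2 * k + 1))))"
  have "?A * (A * ?q N) = partitions_fps (parts24 - ({1..4 * N} \<inter> parts24))"
    unfolding A_def prod_parts24[symmetric] by (rule partitions_fps_remove_finite) auto
  moreover have "?X ^ Suc n dvd \<dots> - 1"
    by (rule partitions_fps_large_parts) (auto simp: N_def)
  ultimately have 1: "?X ^ Suc n dvd ?A * (A * ?q N) - 1" by simp
  have summand: "?X ^ Suc n dvd ?X ^ e * (?q N * ?g i j - 1)"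
    if "k \<le> e" "k \<le> N" "N - k \<le> i" "N - k \<le> j" for e k i j
  proof (cases "k \<le> n")
    case True
    then show ?thesis using that
      by (intro dvd_mult qfact_gauss_binom_fps) (auto simp: N_def)
  next
    case False
    then show ?thesis using that by (intro dvd_mult2 le_imp_power_dvd) auto
  qed
  have "A * ?q N - J = (?q N * ?g N N - 1) + (\<Sum>k=1..N. (- 1) ^ k *
     (?X ^ (k * (2 * k - 1)) * (?q N * ?g (N - k) (N + k) - 1) +
      ?X ^ (k * (2 * k + 1)) * (?q N * ?g (N + k) (N - k) - 1)))"
    unfolding A_def J_def finite_triple_product[OF fps_X_neq_zero]
    by (simp add: algebra_simps sum_distrib_left sum_distrib_right sum.distrib sum_subtractf sum_negf)
  moreover have "?X ^ Suc n dvd \<dots>"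
  proof (rule dvd_add)
    show "?X ^ Suc n dvd ?q N * ?g N N - 1"
      using summand[of 0 0 N N] by simp
  next
    show "?X ^ Suc n dvd (\<Sum>k=1..N. (- 1) ^ k *
       (?X ^ (k * (2 * k - 1)) * (?q N * ?g (N - k) (N + k) - 1) +
        ?X ^ (k * (2 * k + 1)) * (?q N * ?g (N + k) (N - k) - 1)))"
    proof (rule dvd_sum)
      fix k assume k: "k \<in> {1..N}"
      then have "k * 1 \<le> k * (2 * k - 1)" by (intro mult_le_mono) auto
      then have "?X ^ Suc n dvd ?X ^ (k * (2 * k - 1)) * (?q N * ?g (N - k) (N + k) - 1)"
        using k by (intro summand[where k = k]) auto
      moreover have "?X ^ Suc n dvd ?X ^ (k * (2 * k + 1)) * (?q N * ?g (N + k) (N - k) - 1)"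
        using k by (intro summand[where k = k]) auto
      ultimately show "?X ^ Suc n dvd (- 1) ^ k *
         (?X ^ (k * (2 * k - 1)) * (?q N * ?g (N - k) (N + k) - 1) +
          ?X ^ (k * (2 * k + 1)) * (?q N * ?g (N + k) (N - k) - 1))"
        by (intro dvd_mult[OF dvd_add])
    qed
  qed
  ultimately have "?X ^ Suc n dvd A * ?q N - J" by simp
  then have "?X ^ Suc n dvd (?A * (A * ?q N) - 1) - ?A * (A * ?q N - J)"
    by (intro dvd_diff[OF 1 dvd_mult])
  also have "(?A * (A * ?q N) - 1) - ?A * (A * ?q N - J) = ?A * J - 1"
    by (simp add: algebra_simps)
  finally have "fps_nth (?A * J - 1) n = 0"
    by (simp only: fps_X_power_dvd_iff)
  then have 2: "fps_nth (?A * J) n = 0" using assms by simp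
  have sgn: "(- 1 :: int fps) ^ k = fps_const ((- 1) ^ k)" for k
    by (metis fps_const_1_eq_1 fps_const_neg fps_const_power)
  have coeff: "fps_nth (?A * ?X ^ e) n = int (shifted_count n e)" for e
    by (simp add: fps_X_power_mult_right_nth shifted_count_def partitions_fps_def p24_eq)
  have expand: "?A * J = ?A + (\<Sum>k=1..N. fps_const ((- 1) ^ k) *
      (?A * ?X ^ (k * (2 * k - 1)) + ?A * ?X ^ (k * (2 * k + 1))))"
    unfolding J_def sgn by (simp add: algebra_simps sum_distrib_left)
  have "fps_nth (?A * J) n = int (p24 n) + (\<Sum>k=1..N. (- 1) ^ k *
      (int (shifted_count n (k * (2 * k - 1))) + int (shifted_count n (k * (2 * k + 1)))))"
    by (simp only: expand fps_add_nth fps_sum_nth fps_mult_left_const_nth coeff)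
      (simp add: partitions_fps_def p24_eq)
  then show ?thesis unfolding 2 N_def by (rule sym)
qed

section \<open>The recurrence in \<open>\<nu>\<close>\<close>

text \<open>The required rows and \<open>rows_from\<close> only see the class of \<open>a\<close>,
  so they agree on \<open>P\<close> and its filtered part; \<open>rows_below_durfee_iff\<close>
  replaces the Durfee height by a fixed point.\<close>

lemma p24_M_eq:
  assumes "1 \<le> a" "a < 4"
  shows "p24_M a \<nu> n = card (fixed_partitions parts24 a 4 \<nu> n)"
proof -
  have "P \<in> partitions_of n \<and> (\<forall>x \<in># P. \<not> [x = 2] (mod 4)) \<and>
      (let \<alpha> = sum_mset {#x \<in># P. \<not> [x = a] (mod 4)#}
       in {#x \<in># P. [x = a] (mod 4)#} \<in> M_partitions a 4 \<nu> (n - \<alpha>)) \<longleftrightarrow>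
      P \<in> fixed_partitions parts24 a 4 \<nu> n" for P
  proof (cases "P \<in> partitions_in parts24 n")
    case True
    let ?A = "{#x \<in># P. [x = a] (mod 4)#}" and ?B = "{#x \<in># P. \<not> [x = a] (mod 4)#}"
    have "sum_mset ?A + sum_mset ?B = n"
      using True by (metis multiset_partition partitions_in_iff sum_mset.union)
    then have A: "?A \<in> partitions_of (n - sum_mset ?B)"
      using True by (auto simp: partitions_of_def partitions_in_iff)
    have "rows_from a 4 ?A x = rows_from a 4 P x" for x
      by (simp add: rows_from_def filter_filter_mset conj_commute)
        (metis (no_types, lifting))
    then have "?A \<in> M_partitions a 4 \<nu> (n - sum_mset ?B) \<longleftrightarrow> P \<in> fixed_partitions parts24 a 4 \<nu> n"
      unfolding M_partitions_def fixed_partitions_def mem_Collect_eq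
      using A True rows_below_durfee_iff[of 4 ?A a \<nu>] by simp
    with True show ?thesis by (auto simp: partitions_in_def)
  next
    case False
    then show ?thesis by (auto simp: partitions_in_def fixed_partitions_def)
  qed
  then show ?thesis unfolding p24_M_def by (intro arg_cong[where f = card]) auto
qed

text \<open>Among the partitions containing \<open>a, a + 4, ..., a + 4 * \<mu>\<close>, those with
  a fixed point give \<open>p24_M a \<mu> n\<close>; cutting the marked row turns the others into
  those counted by \<open>p24_M a (Suc \<mu>) n\<close>.\<close>

lemma p24_M_recurrence:
  assumes a: "a = 1 \<or> a = 3"
  shows "p24_M a (Suc \<mu>) n + p24_M a \<mu> n = shifted_count n (\<Sum>j\<le>\<mu>. a + 4 * j)"
proof -
  interpret modular_rows parts24 a 4
  proof
    fix x assume "[x = a] (mod 4)"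
    then show "x \<in> parts24" using a by (auto simp: cong_def)
  qed (use a in auto)
  let ?R = "(\<lambda>j. a + 4 * j) ` {..\<mu>}"
  have sub: "mset_set ?R \<subseteq># P \<longleftrightarrow> (\<forall>j\<le>\<mu>. a + 4 * j \<in># P)" for P
  proof
    assume "mset_set ?R \<subseteq># P"
    then have "set_mset (mset_set ?R) \<subseteq> set_mset P" by (rule set_mset_mono)
    then show "\<forall>j\<le>\<mu>. a + 4 * j \<in># P" by auto
  next
    assume "\<forall>j\<le>\<mu>. a + 4 * j \<in># P"
    then have "?R \<subseteq> set_mset P" by auto
    then have "mset_set ?R \<subseteq># mset_set (set_mset P)" by (simp add: subset_imp_msubset_mset_set)
    also have "\<dots> \<subseteq># P" by (rule mset_set_set_mset_msubset)
    finally show "mset_set ?R \<subseteq># P" .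
  qed
  have sum: "sum_mset (mset_set ?R) = (\<Sum>j\<le>\<mu>. a + 4 * j)"
    by (subst sum_unfold_sum_mset[symmetric, of "\<lambda>x. x", simplified]) (auto simp: sum.reindex inj_on_def)
  have "p24_M a (Suc \<mu>) n + p24_M a \<mu> n =
      card (unfixed_partitions \<mu> n) + card (fixed_partitions parts24 a 4 \<mu> n)"
    using a by (auto simp: p24_M_eq card_unfixed_partitions)
  also have "\<dots> = card (unfixed_partitions \<mu> n \<union> fixed_partitions parts24 a 4 \<mu> n)"
    by (rule card_Un_disjoint[symmetric])
      (auto simp: unfixed_partitions_def fixed_partitions_def)
  also have "unfixed_partitions \<mu> n \<union> fixed_partitions parts24 a 4 \<mu> n =
      {P \<in> partitions_in parts24 n. mset_set ?R \<subseteq># P}"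
    unfolding sub by (auto simp: unfixed_partitions_def fixed_partitions_def)
  also have "card \<dots> = shifted_count n (\<Sum>j\<le>\<mu>. a + 4 * j)"
    using S a_pos by (subst card_partitions_in_containing) (auto simp: sum shifted_count_def p24_eq)
  finally show ?thesis .
qed

text \<open>The required part \<open>a + 4 * \<nu>\<close> alone exceeds \<open>n\<close>, which
  ends the recurrence.\<close>

lemma p24_M_eq_0:
  assumes "1 \<le> a" "a < 4" "n < 4 * \<nu>"
  shows "p24_M a \<nu> n = 0"
proof -
  have "fixed_partitions parts24 a 4 \<nu> n = {}"
  proof (safe, goal_cases)
    case (1 P)
    then have "a + 4 * \<nu> \<in># P" "sum_mset P = n" by (auto simp: fixed_partitions_def partitions_in_iff)
    then have "a + 4 * \<nu> \<le> n" by (auto dest: multi_member_split)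
    with assms show ?case by simp
  qed
  with assms show ?thesis by (simp add: p24_M_eq)
qed

theorem theorem1p6:
  fixes \<nu> n :: nat
  assumes "\<nu> \<ge> 1" and "n > \<nu> * (2 * \<nu> + 3)"
  shows "(-1) ^ \<nu> *
           ((\<Sum>\<tau>=0..\<nu>. (-1) ^ \<tau> * int (p24 (n - \<tau> * (2 * \<tau> + 1))))
            - (\<Sum>\<tau>=0..\<nu> - 1. (-1) ^ \<tau> * int (p24 (n - (\<tau> + 1) * (2 * \<tau> + 1)))))
         = int (p24_M 3 \<nu> n) + int (p24_M 1 \<nu> n)"
proof -
  define R where "R k = int (p24_M 3 k n) + int (p24_M 1 k n)" for k
  define D where "D k = int (shifted_count n (k * (2 * k - 1))) + int (shifted_count n (k * (2 * k + 1)))" for k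
  have step: "R (Suc k) + R k = D (Suc k)" for k
  proof -
    have "(\<Sum>j\<le>k. 1 + 4 * j) = Suc k * (2 * Suc k - 1)" "(\<Sum>j\<le>k. 3 + 4 * j) = Suc k * (2 * Suc k + 1)"
      by (induction k) auto
    then show ?thesis
      using p24_M_recurrence[of 1 k n] p24_M_recurrence[of 3 k n] by (simp add: R_def D_def)
  qed
  have R: "(- 1) ^ k * R k = R 0 + (\<Sum>i=1..k. (- 1) ^ i * D i)" for k
  proof (induction k)
    case (Suc k)
    have "(- 1) ^ Suc k * R (Suc k) = (- 1) ^ k * R k + (- 1) ^ Suc k * D (Suc k)"
      unfolding step[symmetric] by (simp add: algebra_simps)
    with Suc show ?case by simp
  qed simp
  \<comment> \<open>This index is the cut-off of \<open>triple_product_recurrence\<close>, so the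
    two alternating sums coincide and \<open>R 0\<close> is \<open>p24 n\<close>.\<close>
  have "R (2 * n + 1) = 0" by (simp add: R_def p24_M_eq_0)
  with R[of "2 * n + 1"] have "R 0 + (\<Sum>i=1..2 * n + 1. (- 1) ^ i * D i) = 0" by simp
  with triple_product_recurrence[of n] assms have R0: "R 0 = int (p24 n)" by (simp add: D_def)
  \<comment> \<open>The lower bound on \<open>n\<close> keeps all subtractions from
    truncating.\<close>
  have D: "D k = int (p24 (n - k * (2 * k - 1))) + int (p24 (n - k * (2 * k + 1)))" if "k \<le> \<nu>" for k
  proof -
    have "k * (2 * k - 1) \<le> \<nu> * (2 * \<nu> + 3)" "k * (2 * k + 1) \<le> \<nu> * (2 * \<nu> + 3)"
      using that by (intro mult_le_mono; simp)+
    with assms show ?thesis by (simp add: D_def shifted_count_def)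
  qed
  have "(\<Sum>\<tau>=0..\<nu>. (-1) ^ \<tau> * int (p24 (n - \<tau> * (2 * \<tau> + 1)))) =
      int (p24 n) + (\<Sum>k=1..\<nu>. (-1) ^ k * int (p24 (n - k * (2 * k + 1))))"
    by (simp add: sum.atLeast_Suc_atMost)
  \<comment> \<open>Reindexing by \<open>k = \<tau> + 1\<close> turns
    \<open>(\<tau> + 1) * (2 * \<tau> + 1)\<close> into \<open>k * (2 * k - 1)\<close> and flips the
    sign.\<close>
  moreover have "(\<Sum>\<tau>=0..\<nu> - 1. (-1) ^ \<tau> * int (p24 (n - (\<tau> + 1) * (2 * \<tau> + 1)))) =
      - (\<Sum>k=1..\<nu>. (-1) ^ k * int (p24 (n - k * (2 * k - 1))))"
  proof -
    obtain \<mu> where \<mu>: "\<nu> = Suc \<mu>" using assms(1) by (cases \<nu>) auto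
    show ?thesis unfolding \<mu> One_nat_def
      by (subst sum.shift_bounds_cl_Suc_ivl) (simp add: sum_negf)
  qed
  moreover have "(\<Sum>k=1..\<nu>. (-1) ^ k * D k) =
      (\<Sum>k=1..\<nu>. (-1) ^ k * int (p24 (n - k * (2 * k - 1)))) +
      (\<Sum>k=1..\<nu>. (-1) ^ k * int (p24 (n - k * (2 * k + 1))))"
    unfolding sum.distrib[symmetric] by (intro sum.cong refl) (simp add: D distrib_left)
  ultimately have "(\<Sum>\<tau>=0..\<nu>. (-1) ^ \<tau> * int (p24 (n - \<tau> * (2 * \<tau> + 1))))
      - (\<Sum>\<tau>=0..\<nu> - 1. (-1) ^ \<tau> * int (p24 (n - (\<tau> + 1) * (2 * \<tau> + 1)))) = (- 1) ^ \<nu> * R \<nu>"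
    using R[of \<nu>] R0 by simp
  then show ?thesis by (simp add: R_def flip: mult.assoc power_mult_distrib)
qed

end
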